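(* Let $f:\mathbb{R}^2\to\mathbb{R}^2$ be defined by $f(x_1,x_2)=\left(\frac{x_1^2-x_2^2}{\sqrt{x_1^2+x_2^2}},\frac{2x_1x_2}{\sqrt{x_1^2+x_2^2}}\right)$ for $(x_1,x_2)\in\mathbb{R}^2\setminus\{\theta\}$ and $f(\theta)=\theta$. Let $z=(z_1,z_2)\in\mathbb{R}^2\setminus\{\theta\}$. Then $f$ is Fréchet differentiable and Mordukhovich differentiable at $z$, with $$\nabla f(z)=\begin{pmatrix}\frac{(z_1^2+3z_2^2)z_1}{(z_1^2+z_2^2)\sqrt{z_1^2+z_2^2}}&\frac{2z_2^2z_2}{(z_1^2+z_2^2)\sqrt{z_1^2+z_2^2}}\\ \frac{-(3z_1^2+z_2^2)z_2}{(z_1^2+z_2^2)\sqrt{z_1^2+z_2^2}}&\frac{2z_1^2z_1}{(z_1^2+z_2^2)\sqrt{z_1^2+z_2^2}}\end{pmatrix}$$ and $$\widehat{D}^*f(z)=\begin{pmatrix}\frac{(z_1^2+3z_2^2)z_1}{(z_1^2+z_2^2)\sqrt{z_1^2+z_2^2}}&\frac{-(3z_1^2+z_2^2)z_2}{(z_1^2+z_2^2)\sqrt{z_1^2+z_2^2}}\\ \frac{2z_2^2z_2}{(z_1^2+z_2^2)\sqrt{z_1^2+z_2^2}}&\frac{2z_1^2z_1}{(z_1^2+z_2^2)\sqrt{z_1^2+z_2^2}}\end{pmatrix}.$$ More precisely, for $x=(x_1,x_2),\,y=(y_1,y_2)\in\mathbb{R}^2$, if $x=\widehat{D}^*f(z)(y)$,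 then $$x_1=y_1\frac{(z_1^2+3z_2^2)z_1}{(z_1^2+z_2^2)\sqrt{z_1^2+z_2^2}}+y_2\frac{2z_2^2z_2}{(z_1^2+z_2^2)\sqrt{z_1^2+z_2^2}},\qquad x_2=y_1\frac{(-3z_1^2-z_2^2)z_2}{(z_1^2+z_2^2)\sqrt{z_1^2+z_2^2}}+y_2\frac{2z_1^2z_1}{(z_1^2+z_2^2)\sqrt{z_1^2+z_2^2}}.$$
   Context: $\theta$ denotes the origin; $\mathbb{R}^2$ has the Euclidean norm and inner product. Vectors are row vectors, and a matrix $A$ represents the linear map $u\mapsto uA$. $f$ is Fréchet differentiable at $z$ with derivative $\nabla f(z)$ (linear) if $\lim_{x\to z}\frac{f(x)-f(z)-\nabla f(z)(x-z)}{\|x-z\|}=\theta$. Mordukhovich derivative: for $y\in\mathbb{R}^2$, $\widehat{D}^*f(z)(y)=\Big\{x\in\mathbb{R}^2:\limsup_{u\to z}\frac{\langle x,u-z\rangle-\langle y,f(u)-f(z)\rangle}{\|u-z\|+\|f(u)-f(z)\|}\le 0\Big\}$ ($f$ is continuous). $f$ is Mordukhovich differentiable at $z$ if this set is nonempty for every $y$. That $\widehat{D}^*f(z)$ equals a matrix $B$ means $\widehat{D}^*f(z)(y)=\{yB\}$ for every $y$; a singleton value is identified with its element. *)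

theory Defs
  imports "HOL-Analysis.Analysis"
begin

definition double_angle_map :: "real^2 \<Rightarrow> real^2" where
  "double_angle_map x = (if x = 0 then 0 else
     vector [((x$1)^2 - (x$2)^2) / sqrt ((x$1)^2 + (x$2)^2),
             (2 * x$1 * x$2) / sqrt ((x$1)^2 + (x$2)^2)])"

text \<open>The Mordukhovich derivative (coderivative) of a single-valued map. This limsup formula
  agrees with the general set-valued one only for continuous \<open>f\<close>. The filter \<open>at z\<close> is
  punctured, so the denominator is never zero along it, and the limsup is taken in the
  extended reals.\<close>

definition mordukhovich_derivative ::
  "('a::euclidean_space \<Rightarrow> 'b::euclidean_space) \<Rightarrow> 'a \<Rightarrow> 'b \<Rightarrow> 'a set" where
  "mordukhovich_derivative f z y =
     {x. Limsup (at z) (\<lambda>u. ereal ((x \<bullet> (u - z) - y \<bullet> (f u - f z)) /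
                                     (norm (u - z) + norm (f u - f z)))) \<le> 0}"

definition mordukhovich_differentiable ::
  "('a::euclidean_space \<Rightarrow> 'b::euclidean_space) \<Rightarrow> 'a \<Rightarrow> bool" where
  "mordukhovich_differentiable f z \<longleftrightarrow> (\<forall>y. mordukhovich_derivative f z y \<noteq> {})"

text \<open>Vectors are row vectors: a matrix \<open>B\<close> acts by \<open>u \<mapsto> u v* B\<close>.
  An equation between a Mordukhovich derivative and a matrix means that every value is the
  corresponding singleton.\<close>

definition mordukhovich_derivative_is_matrix ::
  "(real^'n \<Rightarrow> real^'m) \<Rightarrow> real^'n \<Rightarrow> real^'n^'m \<Rightarrow> bool" where
  "mordukhovich_derivative_is_matrix f z B \<longleftrightarrow>
     (\<forall>y. mordukhovich_derivative f z y = {y v* B})"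

end

theory Submission
  imports Defs
begin

text \<open>A Frechet derivative determines the Mordukhovich derivative: if \<open>f\<close> has derivative
  \<open>D\<close> at \<open>z\<close>, then the numerator of the limsup is \<open>w \<bullet> (u - z) + o(\<parallel>u - z\<parallel>)\<close> with
  \<open>w = x - adjoint D y\<close>, while its denominator is comparable to \<open>\<parallel>u - z\<parallel>\<close>. Approaching
  \<open>z\<close> along \<open>w\<close> shows that the limsup is nonpositive only for \<open>w = 0\<close>. Away from the
  origin the map is smooth, and its partial derivatives are computed by the quotient rule.\<close>

text \<open>The denominator is positive on a punctured neighbourhood, so it can be multiplied out.
  The extended-real limsup thus becomes a family of eventual real inequalities, which combine
  pointwise with the remainder estimate of a derivative.\<close>

lemma mordukhovich_derivative_iff_eventually:
  "x \<in> mordukhovich_derivative f z y \<longleftrightarrow>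
     (\<forall>e>0. \<forall>\<^sub>F u in at z. x \<bullet> (u - z) - y \<bullet> (f u - f z)
        \<le> e * (norm (u - z) + norm (f u - f z)))"
    (is "?L \<longleftrightarrow> (\<forall>e>0. \<forall>\<^sub>F u in at z. ?N u \<le> e * ?M u)")
proof
  have pos: "\<forall>\<^sub>F u in at z. 0 < ?M u"
    unfolding eventually_at_filter
    by (intro always_eventually allI impI add_pos_nonneg) auto
  show "\<forall>e>0. \<forall>\<^sub>F u in at z. ?N u \<le> e * ?M u" if ?L
  proof (intro allI impI)
    fix e :: real assume "0 < e"
    have "Limsup (at z) (\<lambda>u. ereal (?N u / ?M u)) < ereal e"
      using that \<open>0 < e\<close> unfolding mordukhovich_derivative_def
      by (simp add: order.strict_trans1)
    from Limsup_lessD[OF this] pos show "\<forall>\<^sub>F u in at z. ?N u \<le> e * ?M u"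
      by eventually_elim (simp add: divide_less_eq)
  qed
  show ?L if R: "\<forall>e>0. \<forall>\<^sub>F u in at z. ?N u \<le> e * ?M u"
  proof -
    \<comment> \<open>The redundant \<open>0 +\<close> gives the bound the shape that
      \<open>ereal_le_epsilon2\<close> expects when \<open>e\<close> tends to 0.\<close>
    have "Limsup (at z) (\<lambda>u. ereal (?N u / ?M u)) \<le> 0 + ereal e" if "0 < e" for e
    proof (rule Limsup_bounded)
      from R that have "\<forall>\<^sub>F u in at z. ?N u \<le> e * ?M u" by blast
      with pos show "\<forall>\<^sub>F u in at z. ereal (?N u / ?M u) \<le> 0 + ereal e"
        by eventually_elim (simp add: divide_le_eq)
    qed
    then show ?thesis
      unfolding mordukhovich_derivative_def by (auto intro: ereal_le_epsilon2)
  qed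
qed

text \<open>Along the ray \<open>z + t *\<^sub>R w\<close> the left side grows at rate
  \<open>norm w\<close> relative to the distance from \<open>z\<close>, so the tolerance
  \<open>norm w / 2\<close> is already violated unless \<open>w = 0\<close>.\<close>

lemma eq_zero_if_inner_eventually_small:
  fixes w z :: "'a::euclidean_space"
  assumes "\<And>e. e > 0 \<Longrightarrow> \<forall>\<^sub>F u in at z. w \<bullet> (u - z) \<le> e * norm (u - z)"
  shows "w = 0"
proof (rule ccontr)
  assume "w \<noteq> 0"
  then have "0 < norm w / 2" by simp
  from assms[OF this] obtain d where d: "0 < d"
    "\<And>u. u \<noteq> z \<Longrightarrow> dist u z < d \<Longrightarrow> w \<bullet> (u - z) \<le> norm w / 2 * norm (u - z)"
    unfolding eventually_at by blast
  \<comment> \<open>The displacement \<open>t *\<^sub>R w\<close> has norm \<open>d / 2\<close>: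
    nonzero and inside the ball of radius \<open>d\<close>.\<close>
  define t where "t = d / (2 * norm w)"
  have t: "0 < t" "t * norm w = d / 2"
    using d(1) \<open>w \<noteq> 0\<close> by (auto simp: t_def)
  have "w \<bullet> (t *\<^sub>R w) \<le> norm w / 2 * norm (t *\<^sub>R w)"
    using d(2)[of "z + t *\<^sub>R w"] t d(1) \<open>w \<noteq> 0\<close> unfolding dist_norm add_diff_cancel_left' by auto
  then have "t * (norm w)\<^sup>2 \<le> t * (norm w)\<^sup>2 / 2"
    using t(1) unfolding norm_scaleR inner_scaleR_right power2_norm_eq_inner[symmetric]
    by (simp add: power2_eq_square ac_simps)
  with t(1) \<open>w \<noteq> 0\<close> show False by simp
qed

lemma mordukhovich_derivative_eq_adjoint:
  fixes f :: "'a::euclidean_space \<Rightarrow> 'b::euclidean_space"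
  assumes "(f has_derivative D) (at z)"
  shows "mordukhovich_derivative f z y = {adjoint D y}"
proof -
  have "bounded_linear D" using assms by (rule has_derivative_bounded_linear)
  then have "linear D" by (rule bounded_linear.linear)
  obtain K where K: "0 < K" "\<And>h. norm (D h) \<le> norm h * K"
    using bounded_linear.pos_bounded[OF \<open>bounded_linear D\<close>] by blast
  \<comment> \<open>The summand \<open>2 + K\<close> bounds the denominator relative to
    \<open>norm (u - z)\<close>, and \<open>norm y\<close> pays for the remainder in the numerator.
    Running both estimates with tolerance \<open>e / C\<close> gives exactly \<open>e\<close> in
    total.\<close>
  define C where "C = 2 + K + norm y"
  have "C > 0" using K(1) norm_ge_zero[of y] unfolding C_def by linarith
  have small: "\<forall>\<^sub>F u in at z. norm (f u - f z - D (u - z)) \<le> e * norm (u - z)" if "0 < e" for e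
    using assms that unfolding has_derivative_at_alt eventually_at dist_norm by blast
  have rem: "\<bar>y \<bullet> (f u - f z - D (u - z))\<bar> \<le> norm y * (e * norm (u - z))"
    if "norm (f u - f z - D (u - z)) \<le> e * norm (u - z)" for u e
    using Cauchy_Schwarz_ineq2 mult_left_mono[OF that norm_ge_zero] by (rule order_trans)
  have split: "x \<bullet> (u - z) - y \<bullet> (f u - f z)
      = (x - adjoint D y) \<bullet> (u - z) - y \<bullet> (f u - f z - D (u - z))" for x u
    using adjoint_clauses(2)[OF \<open>linear D\<close>, of y "u - z"]
    by (simp add: inner_diff_left inner_diff_right)
  have "x = adjoint D y" if x: "x \<in> mordukhovich_derivative f z y" for x
  proof -
    have "\<forall>\<^sub>F u in at z. (x - adjoint D y) \<bullet> (u - z) \<le> e * norm (u - z)" if "0 < e" for e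
    proof -
      have "0 < e / C" using that \<open>C > 0\<close> by simp
      with x have "\<forall>\<^sub>F u in at z. x \<bullet> (u - z) - y \<bullet> (f u - f z)
          \<le> e / C * (norm (u - z) + norm (f u - f z))"
        unfolding mordukhovich_derivative_iff_eventually by blast
      \<comment> \<open>Differentiability enters twice: tolerance \<open>e / C\<close> controls the
        numerator's remainder, while tolerance 1 gives
        \<open>norm (f u - f z) \<le> (1 + K) * norm (u - z)\<close> for the denominator.\<close>
      with small[OF \<open>0 < e / C\<close>] small[OF zero_less_one] show ?thesis
      proof eventually_elim
        case (elim u)
        have "norm (f u - f z) \<le> norm (f u - f z - D (u - z)) + norm (D (u - z))"
          by (metis diff_add_cancel norm_triangle_ineq)
        with elim(2) K(2)[of "u - z"] have "norm (u - z) + norm (f u - f z) \<le> (2 + K) * norm (u - z)"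
          by (simp add: algebra_simps)
        with \<open>0 < e / C\<close> elim(3) have "x \<bullet> (u - z) - y \<bullet> (f u - f z) \<le> e / C * ((2 + K) * norm (u - z))"
          by (meson mult_left_mono order.trans less_imp_le)
        with rem[OF elim(1)] have "(x - adjoint D y) \<bullet> (u - z)
            \<le> e / C * ((2 + K) * norm (u - z)) + norm y * (e / C * norm (u - z))"
          unfolding split by linarith
        also have "\<dots> = e / C * C * norm (u - z)" unfolding C_def by algebra
        finally show ?case using \<open>C > 0\<close> by simp
      qed
    qed
    from eq_zero_if_inner_eventually_small[OF this] show ?thesis by simp
  qed
  \<comment> \<open>For this point the linear term in \<open>split\<close> vanishes and only the
    remainder is left. Here the denominator is just bounded below by
    \<open>norm (u - z)\<close>.\<close>
  moreover have "adjoint D y \<in> mordukhovich_derivative f z y"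
    unfolding mordukhovich_derivative_iff_eventually
  proof (intro allI impI)
    fix e :: real assume "0 < e"
    then have "0 < e / C" using \<open>C > 0\<close> by simp
    have "norm y * (e / C) \<le> e"
      using \<open>0 < e\<close> \<open>C > 0\<close> K(1) by (simp add: C_def field_simps)
    from small[OF \<open>0 < e / C\<close>] show "\<forall>\<^sub>F u in at z. adjoint D y \<bullet> (u - z) - y \<bullet> (f u - f z)
        \<le> e * (norm (u - z) + norm (f u - f z))"
    proof eventually_elim
      case (elim u)
      have "adjoint D y \<bullet> (u - z) - y \<bullet> (f u - f z) \<le> norm y * (e / C) * norm (u - z)"
        using rem[OF elim] unfolding split by (simp add: abs_le_iff mult.assoc)
      also have "\<dots> \<le> e * norm (u - z)"
        using \<open>norm y * (e / C) \<le> e\<close> by (rule mult_right_mono) simp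
      also have "\<dots> \<le> e * (norm (u - z) + norm (f u - f z))" using \<open>0 < e\<close> by simp
      finally show ?case .
    qed
  qed
  ultimately show ?thesis by blast
qed

text \<open>This is where the transpose relating the two matrices of the theorem comes from. The row
  action of \<open>A\<close> is the column action of \<open>transpose A\<close>, which reduces the
  claim to \<open>adjoint_matrix\<close>.\<close>

lemma adjoint_vector_matrix_mult:
  fixes A :: "real^'n^'m"
  shows "adjoint (\<lambda>u. u v* A) = (\<lambda>y. y v* transpose A)"
  using adjoint_matrix[of "transpose A"]
  by (simp add: vector_transpose_matrix flip: transpose_matrix_vector)

lemma has_derivative_vector_2:
  fixes g h :: "'a::real_normed_vector \<Rightarrow> real"
  assumes "(g has_derivative g') F" "(h has_derivative h') F"
  shows "((\<lambda>x. vector [g x, h x] :: real^2) has_derivative (\<lambda>x. vector [g' x, h' x])) F"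
proof -
  \<comment> \<open>With fixed basis vectors, the derivative rules for sums and scaling
    apply.\<close>
  have *: "vector [a, b] = a *\<^sub>R axis 1 1 + b *\<^sub>R (axis 2 1 :: real^2)" for a b :: real
    by (simp add: vec_eq_iff forall_2 axis_def)
  show ?thesis unfolding * by (intro derivative_intros assms)
qed

text \<open>In complex notation the map is \<open>z^2 / \<bar>z\<bar>\<close> away from 0, and
  \<open>R\<close> is the cube of the norm of \<open>z\<close>. Since vectors act from the left, row
  \<open>i\<close> holds the partial derivatives in the \<open>i\<close>-th variable, so this is the
  transpose of the usual Jacobian.\<close>

lemma has_derivative_double_angle_map:
  fixes z :: "real^2"
  assumes "z \<noteq> 0"
  defines "R \<equiv> ((z$1)^2 + (z$2)^2) * sqrt ((z$1)^2 + (z$2)^2)"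
  shows "(double_angle_map has_derivative (\<lambda>u. u v* (vector
     [vector [((z$1)^2 + 3 * (z$2)^2) * z$1 / R, 2 * (z$2)^2 * z$2 / R],
      vector [- (3 * (z$1)^2 + (z$2)^2) * z$2 / R, 2 * (z$1)^2 * z$1 / R]] :: real^2^2))) (at z)"
proof -
  define s where "s = sqrt ((z$1)^2 + (z$2)^2)"
  have pos: "(z$1)^2 + (z$2)^2 > 0"
    using assms(1) by (auto simp: vec_eq_iff forall_2 sum_power2_gt_zero_iff)
  then have s: "s > 0" "s^2 = (z$1)^2 + (z$2)^2"
    by (auto simp: s_def)
  then have R: "R = s ^ 3"
    unfolding R_def s_def[symmetric] s(2)[symmetric] by (simp add: power3_eq_cube power2_eq_square)
  note coord = bounded_linear.has_derivative[OF bounded_linear_vec_nth has_derivative_ident]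
  have num: "((\<lambda>x::real^2. (x$1)^2 - (x$2)^2) has_derivative
      (\<lambda>u. 2 * z$1 * u$1 - 2 * z$2 * u$2)) (at z)"
    "((\<lambda>x::real^2. 2 * x$1 * x$2) has_derivative
      (\<lambda>u. 2 * z$1 * u$2 + 2 * z$2 * u$1)) (at z)"
    "((\<lambda>x::real^2. (x$1)^2 + (x$2)^2) has_derivative
      (\<lambda>u. 2 * z$1 * u$1 + 2 * z$2 * u$2)) (at z)"
    by (auto intro!: derivative_eq_intros coord simp: algebra_simps)
  have root_nonzero: "sqrt ((z$1)^2 + (z$2)^2) \<noteq> 0"
    unfolding s_def[symmetric] using s(1) by simp
  have sq: "((\<lambda>x::real^2. sqrt ((x$1)^2 + (x$2)^2)) has_derivative
      (\<lambda>u. (z$1 * u$1 + z$2 * u$2) / s)) (at z)"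
    using has_derivative_real_sqrt[OF pos num(3)] unfolding s_def[symmetric]
    by (rule has_derivative_eq_rhs) (use s(1) in \<open>simp add: fun_eq_iff field_simps\<close>)
  \<comment> \<open>The left side is the output of the quotient rule: \<open>p\<close> and
    \<open>q\<close> are the derivative and value of the numerator, \<open>w / s\<close> the
    derivative of the root. In the new numerator the root occurs only squared, so after
    \<open>s(2)\<close> a polynomial identity over the common denominator \<open>s ^ 3\<close>
    remains.\<close>
  have quot: "(p * s - q * (w / s)) / (s * s) = (p * s^2 - q * w) / s ^ 3" for p q w
    using s(1) by (simp add: field_simps power2_eq_square power3_eq_cube)
  have 1: "((\<lambda>x::real^2. ((x$1)^2 - (x$2)^2) / sqrt ((x$1)^2 + (x$2)^2)) has_derivative
      (\<lambda>u. u$1 * (((z$1)^2 + 3 * (z$2)^2) * z$1 / R)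
         + u$2 * (- (3 * (z$1)^2 + (z$2)^2) * z$2 / R))) (at z)"
    using has_derivative_divide'[OF num(1) sq root_nonzero] by (rule has_derivative_eq_rhs)
      (rule ext, simp only: quot flip: s_def,
       simp only: s(2) R times_divide_eq_right flip: add_divide_distrib,
       simp add: power2_eq_square algebra_simps)
  have 2: "((\<lambda>x::real^2. (2 * x$1 * x$2) / sqrt ((x$1)^2 + (x$2)^2)) has_derivative
      (\<lambda>u. u$1 * (2 * (z$2)^2 * z$2 / R) + u$2 * (2 * (z$1)^2 * z$1 / R))) (at z)"
    using has_derivative_divide'[OF num(2) sq root_nonzero] by (rule has_derivative_eq_rhs)
      (rule ext, simp only: quot flip: s_def,
       simp only: s(2) R times_divide_eq_right flip: add_divide_distrib,
       simp add: power2_eq_square algebra_simps)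
  have "((\<lambda>x. vector [((x$1)^2 - (x$2)^2) / sqrt ((x$1)^2 + (x$2)^2),
                      (2 * x$1 * x$2) / sqrt ((x$1)^2 + (x$2)^2)] :: real^2)
      has_derivative (\<lambda>u. u v* (vector
     [vector [((z$1)^2 + 3 * (z$2)^2) * z$1 / R, 2 * (z$2)^2 * z$2 / R],
      vector [- (3 * (z$1)^2 + (z$2)^2) * z$2 / R, 2 * (z$1)^2 * z$1 / R]] :: real^2^2))) (at z)"
    by (rule has_derivative_eq_rhs[OF has_derivative_vector_2[OF 1 2]])
      (simp add: fun_eq_iff vec_eq_iff forall_2 vector_matrix_mult_def sum_2 mult.commute)
  then show ?thesis
    \<comment> \<open>The map agrees with the quotient formula on the open set \<open>- {0}\<close>,
      which contains \<open>z\<close>; this removes the case distinction at the origin.\<close>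
    by (rule has_derivative_transform_within_open[of _ _ _ UNIV "- {0}"])
      (use assms(1) in \<open>auto simp: double_angle_map_def\<close>)
qed

theorem theorem5p3:
  fixes z :: "real^2"
  assumes "z \<noteq> 0"
  shows "double_angle_map differentiable (at z)
    \<and> mordukhovich_differentiable double_angle_map z
    \<and> (double_angle_map has_derivative (\<lambda>u. u v* (vector
         [vector [((z$1)^2 + 3 * (z$2)^2) * z$1 / (((z$1)^2 + (z$2)^2) * sqrt ((z$1)^2 + (z$2)^2)),
                  2 * (z$2)^2 * z$2 / (((z$1)^2 + (z$2)^2) * sqrt ((z$1)^2 + (z$2)^2))],
          vector [- (3 * (z$1)^2 + (z$2)^2) * z$2 / (((z$1)^2 + (z$2)^2) * sqrt ((z$1)^2 + (z$2)^2)),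
                  2 * (z$1)^2 * z$1 / (((z$1)^2 + (z$2)^2) * sqrt ((z$1)^2 + (z$2)^2))]] :: real^2^2)))
        (at z)
    \<and> mordukhovich_derivative_is_matrix double_angle_map z (vector
         [vector [((z$1)^2 + 3 * (z$2)^2) * z$1 / (((z$1)^2 + (z$2)^2) * sqrt ((z$1)^2 + (z$2)^2)),
                  - (3 * (z$1)^2 + (z$2)^2) * z$2 / (((z$1)^2 + (z$2)^2) * sqrt ((z$1)^2 + (z$2)^2))],
          vector [2 * (z$2)^2 * z$2 / (((z$1)^2 + (z$2)^2) * sqrt ((z$1)^2 + (z$2)^2)),
                  2 * (z$1)^2 * z$1 / (((z$1)^2 + (z$2)^2) * sqrt ((z$1)^2 + (z$2)^2))]] :: real^2^2)
    \<and> (\<forall>x y. mordukhovich_derivative double_angle_map z y = {x} \<longrightarrow>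
          x$1 = y$1 * (((z$1)^2 + 3 * (z$2)^2) * z$1 / (((z$1)^2 + (z$2)^2) * sqrt ((z$1)^2 + (z$2)^2)))
              + y$2 * (2 * (z$2)^2 * z$2 / (((z$1)^2 + (z$2)^2) * sqrt ((z$1)^2 + (z$2)^2)))
        \<and> x$2 = y$1 * ((- 3 * (z$1)^2 - (z$2)^2) * z$2 / (((z$1)^2 + (z$2)^2) * sqrt ((z$1)^2 + (z$2)^2)))
              + y$2 * (2 * (z$1)^2 * z$1 / (((z$1)^2 + (z$2)^2) * sqrt ((z$1)^2 + (z$2)^2))))"
proof -
  let ?R = "((z$1)^2 + (z$2)^2) * sqrt ((z$1)^2 + (z$2)^2)"
  let ?A = "vector
     [vector [((z$1)^2 + 3 * (z$2)^2) * z$1 / ?R, 2 * (z$2)^2 * z$2 / ?R],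
      vector [- (3 * (z$1)^2 + (z$2)^2) * z$2 / ?R, 2 * (z$1)^2 * z$1 / ?R]] :: real^2^2"
  let ?B = "vector
     [vector [((z$1)^2 + 3 * (z$2)^2) * z$1 / ?R, - (3 * (z$1)^2 + (z$2)^2) * z$2 / ?R],
      vector [2 * (z$2)^2 * z$2 / ?R, 2 * (z$1)^2 * z$1 / ?R]] :: real^2^2"
  have A: "(double_angle_map has_derivative (\<lambda>u. u v* ?A)) (at z)"
    by (rule has_derivative_double_angle_map[OF assms])
  have "transpose ?A = ?B"
    by (simp add: vec_eq_iff forall_2 transpose_def)
  then have B: "mordukhovich_derivative double_angle_map z y = {y v* ?B}" for y
    using mordukhovich_derivative_eq_adjoint[OF A, of y]
    by (simp only: adjoint_vector_matrix_mult)
  have "(y v* ?B)$1 = y$1 * (((z$1)^2 + 3 * (z$2)^2) * z$1 / ?R) + y$2 * (2 * (z$2)^2 * z$2 / ?R)"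
    "(y v* ?B)$2 = y$1 * ((- 3 * (z$1)^2 - (z$2)^2) * z$2 / ?R) + y$2 * (2 * (z$1)^2 * z$1 / ?R)" for y
    by (simp_all add: vector_matrix_mult_def sum_2 mult.commute)
  then have "\<forall>x y. mordukhovich_derivative double_angle_map z y = {x} \<longrightarrow>
      x$1 = y$1 * (((z$1)^2 + 3 * (z$2)^2) * z$1 / ?R) + y$2 * (2 * (z$2)^2 * z$2 / ?R)
    \<and> x$2 = y$1 * ((- 3 * (z$1)^2 - (z$2)^2) * z$2 / ?R) + y$2 * (2 * (z$1)^2 * z$1 / ?R)"
    \<comment> \<open>The value is the singleton of \<open>y v* ?B\<close>, so the premise forces
      \<open>x\<close> to be that vector.\<close>
    unfolding B singleton_inject by blast
  moreover have "mordukhovich_differentiable double_angle_map z"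
    by (simp add: mordukhovich_differentiable_def B)
  moreover have "mordukhovich_derivative_is_matrix double_angle_map z ?B"
    by (simp add: mordukhovich_derivative_is_matrix_def B)
  ultimately show ?thesis
    using A unfolding differentiable_def by blast
qed

end
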